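(* Let $k,n_1,\dots,n_k,q\ge 2$ be integers. Then the number $l_q(n_1,\dots,n_k)$ of lines in $\mathbb{R}^k$ passing through exactly $q$ points of the grid $G(n_1,\dots,n_k)$ satisfies \[ l_q(n_1,\dots,n_k)=\frac12\bigl(f_{q+1}(n_1,\dots,n_k)-2f_q(n_1,\dots,n_k)+f_{q-1}(n_1,\dots,n_k)\bigr). \]
   Context: For integers $k,n_1,\dots,n_k\ge 2$, let $G(n_1,\dots,n_k)=\{0,\dots,n_1-1\}\times\dots\times\{0,\dots,n_k-1\}\subset\mathbb{R}^k$. For an integer $q\ge 1$, \[ f_q(n_1,\dots,n_k)=\sum_{\substack{-n_1<i_1<n_1,\ \dots,\ -n_k<i_k<n_k\\ \gcd(i_1,\dots,i_k)=q}}(n_1-|i_1|)\cdots(n_k-|i_k|), \] the sum being over integer tuples $(i_1,\dots,i_k)$. The gcd of integers is taken to be nonnegative, with $\gcd(0,\dots,0)=0$. *)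

theory Defs
  imports "HOL-Analysis.Analysis"
begin

(* The dimension k is CARD('k); the tuple (n_1, ..., n_k) is a function on the index type 'k. *)

definition grid :: "('k::finite \<Rightarrow> nat) \<Rightarrow> (real ^ 'k) set" where
  "grid n = {x. \<forall>j. \<exists>m<n j. x $ j = real m}"

definition is_line :: "(real ^ 'k::finite) set \<Rightarrow> bool" where
  "is_line L \<longleftrightarrow> affine L \<and> aff_dim L = 1"

definition grid_lines :: "nat \<Rightarrow> ('k::finite \<Rightarrow> nat) \<Rightarrow> (real ^ 'k) set set" where
  "grid_lines q n = {L. is_line L \<and> finite (L \<inter> grid n) \<and> card (L \<inter> grid n) = q}"

definition num_lines :: "nat \<Rightarrow> ('k::finite \<Rightarrow> nat) \<Rightarrow> nat" where
  "num_lines q n = card (grid_lines q n)"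

(* Gcd on int is nonnegative, and Gcd {0} = 0. *)
definition gcd_sum :: "nat \<Rightarrow> ('k::finite \<Rightarrow> nat) \<Rightarrow> int" where
  "gcd_sum q n =
     (\<Sum>i | (\<forall>j. - int (n j) < i j \<and> i j < int (n j)) \<and> Gcd (range i) = int q.
        \<Prod>j\<in>UNIV. int (n j) - \<bar>i j\<bar>)"

(* The next three lemmas show that the card in num_lines and the sum in gcd_sum
   range over finite sets. *)

lemma finite_grid: "finite (grid n)"
proof -
  have "grid n \<subseteq> (\<lambda>f. \<chi> j. real (f j)) ` (\<Pi>\<^sub>E j\<in>UNIV. {..<n j})"
  proof
    fix x assume "x \<in> grid n"
    then obtain f where f: "\<And>j. f j < n j \<and> x $ j = real (f j)"
      unfolding grid_def by (simp, metis)
    then have "x = (\<chi> j. real (f j))" "f \<in> (\<Pi>\<^sub>E j\<in>UNIV. {..<n j})"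
      by (auto simp: vec_eq_iff)
    then show "x \<in> (\<lambda>f. \<chi> j. real (f j)) ` (\<Pi>\<^sub>E j\<in>UNIV. {..<n j})" by blast
  qed
  then show ?thesis
    by (rule finite_subset) (intro finite_imageI finite_PiE; simp)
qed

lemma finite_gcd_sum_index:
  "finite {i :: 'k::finite \<Rightarrow> int.
     (\<forall>j. - int (n j) < i j \<and> i j < int (n j)) \<and> Gcd (range i) = int q}"
proof (rule finite_subset)
  show "{i. (\<forall>j. - int (n j) < i j \<and> i j < int (n j)) \<and> Gcd (range i) = int q}
      \<subseteq> (\<Pi>\<^sub>E j\<in>UNIV. {- int (n j)<..<int (n j)})"
    by auto
qed (intro finite_PiE; simp)

lemma finite_grid_lines:
  assumes "q \<ge> 2"
  shows "finite (grid_lines q n)"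
proof -
  have "grid_lines q n \<subseteq> (\<lambda>S. affine hull S) ` Pow (grid n)"
  proof
    fix L assume "L \<in> grid_lines q n"
    then have L: "affine L" "aff_dim L = 1" and c: "card (L \<inter> grid n) \<ge> 2"
      using assms by (auto simp: grid_lines_def is_line_def)
    then obtain a b where ab: "a \<in> L \<inter> grid n" "b \<in> L \<inter> grid n" "a \<noteq> b"
      by (metis card_le_Suc0_iff_eq finite_Int finite_grid not_less_eq_eq numeral_2_eq_2)
    have "affine hull {a, b} \<subseteq> L"
      using ab L(1) by (simp add: hull_minimal)
    moreover have "aff_dim (affine hull {a, b}) = aff_dim L"
      using ab(3) L(2) by simp
    ultimately have "affine hull {a, b} = L"
      using affine_dim_equal[of "affine hull {a, b}" L] L(1) by auto
    then show "L \<in> (\<lambda>S. affine hull S) ` Pow (grid n)" using ab by blast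
  qed
  then show ?thesis
    by (rule finite_subset) (simp add: finite_grid)
qed

end

theory Submission imports Defs begin

text \<open>
  The product in the summand of \<open>gcd_sum q n\<close> counts the grid points \<open>x\<close> for which \<open>x + i\<close> is again
  a grid point, so \<open>gcd_sum q n\<close> is the number of ordered pairs of grid points whose difference has
  gcd \<open>q\<close>. A line with \<open>m \<ge> 2\<close> grid points meets the grid in consecutive points
  \<open>x + t v\<close> with \<open>v\<close> primitive, hence it carries exactly \<open>2 max (m - q) 0\<close> such pairs.
  The second difference of \<open>q \<mapsto> max (m - q) 0\<close> is the indicator of \<open>m = q\<close>.
\<close>

section \<open>Integer model of the grid\<close>

text \<open>The grid is copied to integer-valued functions because gcds of coordinate differences
  make sense there; \<open>real_vec\<close> carries the copy back into the real space where lines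
  live.\<close>

definition box_points :: "('k::finite \<Rightarrow> nat) \<Rightarrow> ('k \<Rightarrow> int) set" where
  "box_points n = {x. \<forall>j. 0 \<le> x j \<and> x j < int (n j)}"

definition real_vec :: "('k::finite \<Rightarrow> int) \<Rightarrow> real ^ 'k" where
  "real_vec x = (\<chi> j. real_of_int (x j))"

definition gcd_pairs :: "nat \<Rightarrow> ('k \<Rightarrow> int) set \<Rightarrow> (('k \<Rightarrow> int) \<times> ('k \<Rightarrow> int)) set" where
  "gcd_pairs q A = {(x, y) \<in> A \<times> A. Gcd (range (\<lambda>j. y j - x j)) = int q}"

lemma real_vec_nth [simp]: "real_vec x $ j = real_of_int (x j)"
  by (simp add: real_vec_def)

lemma inj_real_vec: "inj real_vec"
  by (auto simp: inj_def vec_eq_iff)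

lemma grid_eq_image: "grid n = real_vec ` box_points n"
proof (intro equalityI subsetI)
  fix x assume "x \<in> grid n"
  then obtain f where f: "\<And>j. f j < n j \<and> x $ j = real (f j)"
    unfolding grid_def by (simp, metis)
  then have "x = real_vec (\<lambda>j. int (f j))" "(\<lambda>j. int (f j)) \<in> box_points n"
    by (auto simp: vec_eq_iff box_points_def)
  then show "x \<in> real_vec ` box_points n" by blast
next
  fix x assume "x \<in> real_vec ` box_points n"
  then obtain y where y: "y \<in> box_points n" "x = real_vec y" by blast
  show "x \<in> grid n" unfolding grid_def
  proof (intro CollectI allI)
    fix j
    have "nat (y j) < n j" "x $ j = real (nat (y j))"
      using y by (auto simp: box_points_def dest: spec[of _ j])
    then show "\<exists>m<n j. x $ j = real m" by blast
  qed
qed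

lemma finite_box_points: "finite (box_points n)"
  using finite_grid[of n] inj_real_vec
  by (metis finite_imageD grid_eq_image inj_on_subset subset_UNIV)

section \<open>Counting grid pairs by their difference\<close>

text \<open>The two membership conditions decouple over the coordinates: \<open>x j\<close> ranges
  over an integer interval obtained by intersecting \<open>[0, n j)\<close> with its translate by
  \<open>- i j\<close>. The bounds on \<open>i\<close> keep each of these intervals nonempty, so its
  cardinality is the integer difference of its endpoints.\<close>

lemma card_box_points_shift:
  assumes "\<And>j. - int (n j) < i j \<and> i j < int (n j)"
  shows "int (card {x \<in> box_points n. (\<lambda>j. x j + i j) \<in> box_points n})
    = (\<Prod>j\<in>UNIV. int (n j) - \<bar>i j\<bar>)"
proof -
  have "{x \<in> box_points n. (\<lambda>j. x j + i j) \<in> box_points n}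
      = (\<Pi>\<^sub>E j\<in>UNIV. {max 0 (- i j)..<min (int (n j)) (int (n j) - i j)})"
    by (auto simp: box_points_def PiE_def Pi_def) (smt (verit))+
  moreover have "int (card {max 0 (- i j)..<min (int (n j)) (int (n j) - i j)})
      = int (n j) - \<bar>i j\<bar>" for j
    using assms[of j] by auto
  ultimately show ?thesis by (simp add: card_PiE)
qed

lemma gcd_sum_eq_card: "gcd_sum q n = int (card (gcd_pairs q (box_points n)))"
proof -
  define I where "I = {i. (\<forall>j. - int (n j) < i j \<and> i j < int (n j)) \<and> Gcd (range i) = int q}"
  define X where "X i = {x \<in> box_points n. (\<lambda>j. x j + i j) \<in> box_points n}" for i
  have bij: "bij_betw (\<lambda>(i, x). (x, \<lambda>j. x j + i j)) (Sigma I X) (gcd_pairs q (box_points n))"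
  proof (rule bij_betwI[where g = "\<lambda>(x, y). (\<lambda>j. y j - x j, x)"])
    \<comment> \<open>The difference of two box points automatically satisfies the strict bounds
      imposed in \<open>I\<close>.\<close>
    show "(\<lambda>(x, y). (\<lambda>j. y j - x j, x)) \<in> gcd_pairs q (box_points n) \<rightarrow> Sigma I X"
      by (auto simp: gcd_pairs_def I_def X_def box_points_def) (smt (verit))+
  qed (auto simp: gcd_pairs_def I_def X_def)
  have "gcd_sum q n = (\<Sum>i\<in>I. \<Prod>j\<in>UNIV. int (n j) - \<bar>i j\<bar>)"
    by (simp add: gcd_sum_def I_def)
  also have "\<dots> = (\<Sum>i\<in>I. int (card (X i)))"
    unfolding X_def by (intro sum.cong refl card_box_points_shift[symmetric]) (auto simp: I_def)
  also have "\<dots> = int (card (Sigma I X))"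
    by (subst card_SigmaI)
      (auto simp: I_def X_def finite_gcd_sum_index intro: finite_subset[OF _ finite_box_points])
  finally show ?thesis using bij_betw_same_card[OF bij] by simp
qed

section \<open>Lattice points on a line\<close>

lemma line_eq_affine_hull:
  assumes "is_line L" "a \<in> L" "b \<in> L" "a \<noteq> b"
  shows "L = affine hull {a, b}"
proof -
  have "affine hull {a, b} \<subseteq> L"
    using assms by (simp add: hull_minimal is_line_def)
  moreover have "aff_dim (affine hull {a, b}) = aff_dim L"
    using assms by (simp add: is_line_def)
  ultimately show ?thesis
    using affine_dim_equal[of "affine hull {a, b}" L] assms by (auto simp: is_line_def)
qed

lemma is_line_affine_hull:
  assumes "a \<noteq> b"
  shows "is_line (affine hull {a, b})"
  using assms by (simp add: is_line_def)

lemma Gcd_range_mult: "Gcd (range (\<lambda>j. c * v j)) = \<bar>c\<bar> * Gcd (range v)" for c :: int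
  using Gcd_mult[of c "range v"] by (simp add: image_image abs_mult normalize_mult)

lemma Gcd_range_1_nonzero:
  fixes v :: "'k \<Rightarrow> int"
  assumes "Gcd (range v) = 1"
  obtains i where "v i \<noteq> 0"
proof -
  have "\<not> range v \<subseteq> {0}" using assms by (metis Gcd_0_iff zero_neq_one)
  then show ?thesis using that by blast
qed

text \<open>If \<open>w = t v\<close> then \<open>w i v = v i w\<close>; the gcds of both sides show that \<open>v i\<close> divides \<open>w i\<close>.\<close>

lemma primitive_multiple_int:
  fixes v w :: "'k::finite \<Rightarrow> int"
  assumes v: "Gcd (range v) = 1" and w: "\<And>j. real_of_int (w j) = t * real_of_int (v j)"
  obtains s where "t = real_of_int s"
proof -
  obtain i where i: "v i \<noteq> 0" using Gcd_range_1_nonzero[OF v] .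
  have "w i * v j = v i * w j" for j
  proof -
    have "real_of_int (w i * v j) = real_of_int (v i * w j)" by (simp add: w)
    then show ?thesis by linarith
  qed
  then have "\<bar>w i\<bar> * Gcd (range v) = \<bar>v i\<bar> * Gcd (range w)"
    by (simp flip: Gcd_range_mult)
  then have "v i dvd w i" using v by (metis abs_dvd_iff dvd_abs_iff dvd_triv_left mult.right_neutral)
  then obtain s where "w i = v i * s" by blast
  then have "t = real_of_int s" using w[of i] i by simp
  then show ?thesis using that by blast
qed

text \<open>The direction \<open>v\<close> is \<open>y - x\<close> divided by the gcd of its
  entries. Being primitive, it leaves no lattice point of the line between consecutive integer
  parameters, so the lattice points are exactly an arithmetic progression through
  \<open>x\<close>.\<close>

lemma line_lattice_points:
  fixes L :: "(real ^ 'k::finite) set"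
  assumes L: "is_line L" and xy: "real_vec x \<in> L" "real_vec y \<in> L" "x \<noteq> y"
  obtains v where "Gcd (range v) = 1"
    and "\<And>z. real_vec z \<in> L \<longleftrightarrow> (\<exists>t. z = (\<lambda>j. x j + t * v j))"
proof -
  define d where "d = Gcd (range (\<lambda>j. y j - x j))"
  have d: "d > 0"
  proof -
    obtain i where "x i \<noteq> y i" using xy(3) by blast
    then have "y i - x i \<notin> {0}" by simp
    then have "d \<noteq> 0" unfolding d_def Gcd_0_iff by blast
    moreover have "d \<ge> 0" by (simp add: d_def)
    ultimately show ?thesis by simp
  qed
  define v where "v j = (y j - x j) div d" for j
  have v: "y j - x j = d * v j" for j
    by (simp add: v_def d_def Gcd_dvd)
  have "d = Gcd (range (\<lambda>j. d * v j))" by (simp flip: v d_def)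
  then have "d = d * Gcd (range v)" using d by (simp only: Gcd_range_mult abs_of_pos)
  then have gv: "Gcd (range v) = 1" using d by simp
  have "real_vec x \<noteq> real_vec y" using xy(3) inj_real_vec by (auto dest: injD)
  from line_eq_affine_hull[OF L xy(1,2) this]
  have Leq: "p \<in> L \<longleftrightarrow> (\<exists>u. p = real_vec x + u *\<^sub>R (real_vec y - real_vec x))" for p
    by (auto simp: affine_hull_2_alt)
  have "real_vec z \<in> L \<longleftrightarrow> (\<exists>t. z = (\<lambda>j. x j + t * v j))" for z
  proof
    assume "real_vec z \<in> L"
    then obtain u where u: "real_vec z = real_vec x + u *\<^sub>R (real_vec y - real_vec x)"
      using Leq by blast
    \<comment> \<open>A real step \<open>u\<close> along \<open>y - x = d v\<close> is a step
      \<open>u * d\<close> along \<open>v\<close>; integrality of \<open>z - x\<close> and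
      primitivity of \<open>v\<close> then force \<open>u * d\<close> to be an integer.\<close>
    have uv: "real_of_int (z j - x j) = (u * d) * real_of_int (v j)" for j
    proof -
      have "real_of_int (z j) = real_of_int (x j) + u * real_of_int (y j - x j)"
        using arg_cong[OF u, of "\<lambda>p. p $ j"] by simp
      then show ?thesis unfolding v by simp
    qed
    obtain s where s: "u * d = real_of_int s" using primitive_multiple_int[OF gv uv] .
    have "z j - x j = s * v j" for j
      using uv[of j] unfolding s by (metis of_int_eq_iff of_int_mult)
    then have "z = (\<lambda>j. x j + s * v j)" by (auto simp: fun_eq_iff algebra_simps)
    then show "\<exists>t. z = (\<lambda>j. x j + t * v j)" by blast
  next
    assume "\<exists>t. z = (\<lambda>j. x j + t * v j)"
    then obtain t where t: "z = (\<lambda>j. x j + t * v j)" by blast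
    have "real_of_int (y j) = real_of_int (x j) + d * v j" for j
      using v[of j] by (metis add_diff_cancel_left' diff_add_cancel of_int_add of_int_mult add.commute)
    \<comment> \<open>Conversely, \<open>t\<close> steps along \<open>v\<close> amount to the real
      parameter \<open>t / d\<close> along \<open>y - x\<close>.\<close>
    then have "real_vec z = real_vec x + (t / d) *\<^sub>R (real_vec y - real_vec x)"
      using d by (simp add: vec_eq_iff t)
    then show "real_vec z \<in> L" using Leq by blast
  qed
  with gv show ?thesis using that by blast
qed

section \<open>Counting the pairs on one line\<close>

lemma int_convex_eq_atLeastAtMost:
  fixes S :: "int set"
  assumes "finite S" "S \<noteq> {}" and "\<And>a b t. a \<in> S \<Longrightarrow> b \<in> S \<Longrightarrow> a \<le> t \<Longrightarrow> t \<le> b \<Longrightarrow> t \<in> S"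
  shows "S = {Min S..Max S}"
proof (intro equalityI subsetI)
  fix t assume "t \<in> S"
  then show "t \<in> {Min S..Max S}" using assms(1) by simp
next
  fix t assume "t \<in> {Min S..Max S}"
  then show "t \<in> S" using assms(3)[OF Min_in Max_in] assms(1,2) by simp
qed

text \<open>The sign of \<open>t - s\<close> splits the pairs into two families, each indexed by the
  smaller entry, which runs over \<open>{a..b - int q}\<close>. They are disjoint because
  \<open>q\<close> is positive. Truncated subtraction gives 0 exactly when no smaller entry is
  available.\<close>

lemma card_int_pairs_dist:
  fixes a b :: int
  assumes "q \<ge> 1"
  shows "card {(s, t) \<in> {a..b} \<times> {a..b}. \<bar>t - s\<bar> = int q} = 2 * (card {a..b} - q)"
proof -
  have "{(s, t) \<in> {a..b} \<times> {a..b}. \<bar>t - s\<bar> = int q}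
      = (\<lambda>s. (s, s + int q)) ` {a..b - int q} \<union> (\<lambda>s. (s + int q, s)) ` {a..b - int q}"
    by (auto simp: image_iff abs_if split: if_splits)
  also have "card \<dots> = card {a..b - int q} + card {a..b - int q}"
    using assms by (subst card_Un_disjoint) (auto simp: card_image inj_on_def)
  also have "\<dots> = 2 * (card {a..b} - q)" by auto
  finally show ?thesis .
qed

text \<open>Parametrizing the lattice points of the line by a primitive direction turns its grid
  points into an integer interval and the gcd of a difference into the distance of the parameters,
  which reduces the claim to \<open>card_int_pairs_dist\<close>.\<close>

lemma card_gcd_pairs_line:
  fixes n :: "'k::finite \<Rightarrow> nat"
  assumes L: "is_line L" and m: "card (L \<inter> grid n) \<ge> 2" and q: "q \<ge> 1"
  shows "card (gcd_pairs q {z \<in> box_points n. real_vec z \<in> L}) = 2 * (card (L \<inter> grid n) - q)"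
proof -
  define Z where "Z = {z \<in> box_points n. real_vec z \<in> L}"
  have "L \<inter> grid n = real_vec ` Z" by (auto simp: Z_def grid_eq_image)
  then have cZ: "card (L \<inter> grid n) = card Z"
    using inj_real_vec by (metis card_image inj_on_subset subset_UNIV)
  have finZ: "finite Z" by (simp add: Z_def finite_box_points)
  then obtain x y where xy: "x \<in> Z" "y \<in> Z" "x \<noteq> y"
    using m cZ by (metis card_le_Suc0_iff_eq not_less_eq_eq numeral_2_eq_2)
  obtain v where v: "Gcd (range v) = 1"
    and L_iff: "\<And>z. real_vec z \<in> L \<longleftrightarrow> (\<exists>t. z = (\<lambda>j. x j + t * v j))"
    using line_lattice_points[OF L, of x y] xy by (auto simp: Z_def)
  define p where "p t = (\<lambda>j. x j + t * v j)" for t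
  obtain i where i: "v i \<noteq> 0" using Gcd_range_1_nonzero[OF v] .
  have injp: "inj p"
  proof (rule injI)
    fix s t assume "p s = p t"
    then have "p s i = p t i" by simp
    then show "s = t" using i by (simp add: p_def)
  qed
  define S where "S = {t. p t \<in> box_points n}"
  have ZS: "Z = p ` S" by (auto simp: Z_def S_def L_iff p_def)
  have finS: "finite S" using finZ injp ZS by (metis finite_imageD inj_on_subset subset_UNIV)
  have cS: "card Z = card S" unfolding ZS using injp by (metis card_image inj_on_subset subset_UNIV)
  have convS: "t \<in> S" if "a \<in> S" "b \<in> S" "a \<le> t" "t \<le> b" for a b t
  proof -
    have "0 \<le> p t j \<and> p t j < int (n j)" for j
    proof -
      \<comment> \<open>Each coordinate of \<open>p t\<close> is affine in \<open>t\<close>, so it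
        lies between its values at \<open>a\<close> and \<open>b\<close>; this is the convexity of
        the box restricted to the progression.\<close>
      have "min (a * v j) (b * v j) \<le> t * v j \<and> t * v j \<le> max (a * v j) (b * v j)"
        using that(3,4) by (cases "v j \<ge> 0")
          (auto simp: min_def max_def mult_right_mono mult_right_mono_neg)
      moreover have "0 \<le> p a j \<and> p a j < int (n j)" "0 \<le> p b j \<and> p b j < int (n j)"
        using that(1,2) by (auto simp: S_def box_points_def)
      ultimately show ?thesis unfolding p_def by linarith
    qed
    then show ?thesis by (simp add: S_def box_points_def)
  qed
  have "S \<noteq> {}" using xy(1) ZS by blast
  with finS have "S = {Min S..Max S}"
    by (rule int_convex_eq_atLeastAtMost) (fact convS)
  then obtain a b where S_eq: "S = {a..b}" by blast
  \<comment> \<open>The difference is \<open>t - s\<close> times \<open>v\<close>, and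
    \<open>v\<close> has gcd 1.\<close>
  have gcd_p: "Gcd (range (\<lambda>j. p t j - p s j)) = \<bar>t - s\<bar>" for s t
    using Gcd_range_mult[of "t - s" v] v by (simp add: p_def algebra_simps)
  have "gcd_pairs q Z = map_prod p p ` {(s, t) \<in> S \<times> S. \<bar>t - s\<bar> = int q}"
    by (auto simp: gcd_pairs_def ZS gcd_p)
  then have "card (gcd_pairs q Z) = card {(s, t) \<in> S \<times> S. \<bar>t - s\<bar> = int q}"
    using card_image[OF inj_on_subset[OF prod.inj_map[OF injp injp] subset_UNIV]] by simp
  also have "\<dots> = 2 * (card S - q)"
    unfolding S_eq using card_int_pairs_dist[OF q] .
  finally show ?thesis by (simp add: Z_def[symmetric] cZ cS)
qed

section \<open>Summing over all lines\<close>

text \<open>These are the lines that carry a pair of distinct grid points; restricting to them gives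
  a finite index set.\<close>

definition rich_lines :: "('k::finite \<Rightarrow> nat) \<Rightarrow> (real ^ 'k) set set" where
  "rich_lines n = {L. is_line L \<and> card (L \<inter> grid n) \<ge> 2}"

lemma finite_rich_lines: "finite (rich_lines n)"
proof (rule finite_subset)
  \<comment> \<open>A rich line meets the grid in at least 2 and at most
    \<open>card (grid n)\<close> points, so finitely many of the finite sets
    \<open>grid_lines q n\<close> cover all rich lines.\<close>
  show "rich_lines n \<subseteq> (\<Union>q\<in>{2..card (grid n)}. grid_lines q n)"
    by (auto simp: rich_lines_def grid_lines_def finite_grid intro!: card_mono)
qed (auto intro: finite_grid_lines)

text \<open>Every counted pair has distinct entries and so spans exactly one line, which is rich.
  The pairs are thereby partitioned by line, and \<open>card_gcd_pairs_line\<close> counts each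
  class.\<close>

lemma card_gcd_pairs_box:
  assumes q: "q \<ge> 1"
  shows "card (gcd_pairs q (box_points n)) = (\<Sum>L\<in>rich_lines n. 2 * (card (L \<inter> grid n) - q))"
proof -
  define P where "P L = gcd_pairs q {z \<in> box_points n. real_vec z \<in> L}" for L
  \<comment> \<open>Equal entries would give the zero difference, whose gcd is 0, whereas
    \<open>q\<close> is positive.\<close>
  have ne: "x \<noteq> y" if "(x, y) \<in> gcd_pairs q A" for x y :: "'a \<Rightarrow> int" and A
    using that q by (auto simp: gcd_pairs_def)
  have "gcd_pairs q (box_points n) \<subseteq> (\<Union>L\<in>rich_lines n. P L)"
  proof clarify
    fix x y assume xy: "(x, y) \<in> gcd_pairs q (box_points n)"
    let ?L = "affine hull {real_vec x, real_vec y}"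
    have xy': "real_vec x \<noteq> real_vec y" using ne[OF xy] inj_real_vec by (auto dest: injD)
    have "{real_vec x, real_vec y} \<subseteq> ?L \<inter> grid n"
      using xy by (auto simp: gcd_pairs_def grid_eq_image hull_inc)
    from card_mono[OF _ this] have "card (?L \<inter> grid n) \<ge> 2"
      using xy' by (simp add: finite_grid)
    then have "?L \<in> rich_lines n" using is_line_affine_hull[OF xy'] by (simp add: rich_lines_def)
    moreover have "(x, y) \<in> P ?L" using xy by (auto simp: P_def gcd_pairs_def hull_inc)
    ultimately show "(x, y) \<in> (\<Union>L\<in>rich_lines n. P L)" by blast
  qed
  then have eq: "gcd_pairs q (box_points n) = (\<Union>L\<in>rich_lines n. P L)"
    by (auto simp: P_def gcd_pairs_def)
  have "P L \<inter> P L' = {}" if "L \<in> rich_lines n" "L' \<in> rich_lines n" "L \<noteq> L'" for L L'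
  proof (rule ccontr)
    assume "P L \<inter> P L' \<noteq> {}"
    then obtain x y where xy: "(x, y) \<in> P L" "(x, y) \<in> P L'" by auto
    have "real_vec x \<noteq> real_vec y"
      using ne xy(1) inj_real_vec by (auto simp: P_def dest: injD)
    \<comment> \<open>A pair lying on both lines would identify each of them with its own affine
      hull.\<close>
    then have "M = affine hull {real_vec x, real_vec y}" if "M \<in> {L, L'}" for M
      using xy \<open>L \<in> rich_lines n\<close> \<open>L' \<in> rich_lines n\<close> that
      by (intro line_eq_affine_hull) (auto simp: P_def gcd_pairs_def rich_lines_def)
    with that(3) show False by blast
  qed
  moreover have "finite (P L)" for L
    by (rule finite_subset[of _ "box_points n \<times> box_points n"])
      (auto simp: P_def gcd_pairs_def finite_box_points)
  ultimately have "card (\<Union>L\<in>rich_lines n. P L) = (\<Sum>L\<in>rich_lines n. card (P L))"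
    by (intro card_UN_disjoint finite_rich_lines) auto
  also have "\<dots> = (\<Sum>L\<in>rich_lines n. 2 * (card (L \<inter> grid n) - q))"
    unfolding P_def using q
    by (intro sum.cong refl card_gcd_pairs_line) (auto simp: rich_lines_def)
  finally show ?thesis by (simp add: eq)
qed

theorem corollary2:
  fixes n :: "'k::finite \<Rightarrow> nat" and q :: nat
  assumes "CARD('k) \<ge> 2" and "\<And>j. n j \<ge> 2" and "q \<ge> 2"
  shows "real (num_lines q n) =
    1 / 2 * real_of_int (gcd_sum (q + 1) n - 2 * gcd_sum q n + gcd_sum (q - 1) n)"
proof -
  let ?m = "\<lambda>L. card (L \<inter> grid n)"
  \<comment> \<open>The bound \<open>r \<ge> 1\<close> holds at \<open>q - 1\<close> as well, since
    \<open>q \<ge> 2\<close>.\<close>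
  have f: "gcd_sum r n = (\<Sum>L\<in>rich_lines n. 2 * int (?m L - r))" if "r \<ge> 1" for r
    using that by (simp add: gcd_sum_eq_card card_gcd_pairs_box)
  have "gcd_sum (q + 1) n - 2 * gcd_sum q n + gcd_sum (q - 1) n
      = (\<Sum>L\<in>rich_lines n. 2 * int (?m L - (q + 1)) - 2 * (2 * int (?m L - q))
          + 2 * int (?m L - (q - 1)))"
    using assms(3) by (simp only: f sum.distrib sum_subtractf sum_distrib_left)
  \<comment> \<open>Natural subtraction supplies the truncation at 0. Terms with
    \<open>?m L < q\<close> vanish one by one, those with \<open>?m L > q\<close> cancel by
    linearity, and \<open>?m L = q\<close> leaves only the last summand, which is 2.\<close>
  also have "\<dots> = (\<Sum>L\<in>rich_lines n. if ?m L = q then 2 else 0)"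
    using assms(3) by (intro sum.cong refl) auto
  also have "\<dots> = 2 * int (card {L \<in> rich_lines n. ?m L = q})"
    by (simp add: sum.If_cases finite_rich_lines Int_def)
  \<comment> \<open>As \<open>q \<ge> 2\<close>, a line with exactly \<open>q\<close> grid points is
    rich.\<close>
  also have "{L \<in> rich_lines n. ?m L = q} = grid_lines q n"
    using assms(3) by (auto simp: rich_lines_def grid_lines_def finite_grid)
  finally show ?thesis by (simp add: num_lines_def)
qed

end
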